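(* Let $L$ be a limit problem in which every expression is a polynomial, and let $\sigma$ be an integer substitution (on the abstract coefficients) with $\sigma\models\mathrm{smt}(L)$. Then the family $\sigma_n\circ\sigma=\{x/(m_x\sigma\cdot n+k_x\sigma)\mid x\in\mathcal{V}(L)\}$, $n\in\mathbb{N}$, is a solution of $L$.
   Context: Variables range over $\mathbb{Z}$. A limit problem is a finite set of marked expressions $a^\bullet$ with $a$ an arithmetic expression and $\bullet\in\{+,-,+_!,-_!\}$; $\mathcal{V}(L)$ is the set of variables occurring in $L$. A function $f:\mathbb{N}\to\mathbb{R}$ satisfies $+$ (resp. $-$) if $\lim_{n\to\infty}f(n)=\infty$ (resp. $-\infty$), and satisfies $+_!$ (resp. $-_!$) if $\lim_{n\to\infty}f(n)=m$ for some real $m>0$ (resp. $m<0$). A family $(\sigma_n)_{n\in\mathbb{N}}$ of integer substitutions whose domains contain all variables of $L$ is a solution of $L$ if for every $a^\bullet\in L$ the function $n\mapsto a\sigma_n$ satisfies $\bullet$. For each variable $x$ introduce fresh integer-valued variables (abstract coefficients) $m_x,k_x$, and let $\sigma_n$ be the substitution $x\mapsto m_x\cdot n+k_x$. For a polynomial $a$ of degree $d$, write $a\sigma_n=a_d\cdot n^d+\dots+a_0\cdot n^0$ where $a_0,\dots,a_d$ are expressions over the abstract coefficients not containing $n$. Define $\mathrm{smt}(a^+)=\bigvee_{i=1}^d(a_i>0\land\bigwedge_{j=i+1}^d a_j=0)$, $\mathrm{smt}(a^-)=\bigvee_{i=1}^d(a_i<0\land\bigwedge_{j=i+1}^d a_j=0)$,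 $\mathrm{smt}(a^{+_!})=\bigwedge_{j=1}^d a_j=0\land a_0>0$, $\mathrm{smt}(a^{-_!})=\bigwedge_{j=1}^d a_j=0\land a_0<0$, and $\mathrm{smt}(L)=\bigwedge_{a^\bullet\in L}\mathrm{smt}(a^\bullet)$. An integer substitution $\sigma\models\varphi$ means all variables of $\varphi$ are in its domain and $\sigma$ is a model of $\varphi$; composition satisfies $t(\sigma_n\circ\sigma)=t\sigma_n\sigma$. *)

theory Defs
  imports
    Complex_Main
    "HOL-Library.Poly_Mapping"
    "HOL-Library.FSet"
    "HOL-Computational_Algebra.Polynomial"
begin

subsection \<open>Arithmetic expressions and integer substitutions\<close>

datatype (avars: 'v) aexp =
    AVar 'v
  | ANum real
  | ANeg "'v aexp"
  | AAdd "'v aexp" "'v aexp"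
  | ASub "'v aexp" "'v aexp"
  | AMul "'v aexp" "'v aexp"
  | ADiv "'v aexp" "'v aexp"
  | AExp "'v aexp" "'v aexp"

type_synonym 'v int_subst = "'v \<rightharpoonup> int"

text \<open>
  Real exponentiation that is also correct for non-positive bases when the exponent is an integer
  (\<open>powr\<close> alone is not).
\<close>
definition real_expt :: "real \<Rightarrow> real \<Rightarrow> real" where
  "real_expt x y = (if y \<in> \<int> then x powi \<lfloor>y\<rfloor> else x powr y)"

text \<open>
  The value of \<open>a\<sigma>\<close>. It is only meaningful if \<open>avars a \<subseteq> dom \<sigma>\<close>.
\<close>
primrec aeval :: "'v int_subst \<Rightarrow> 'v aexp \<Rightarrow> real" where
  "aeval \<sigma> (AVar x) = real_of_int (the (\<sigma> x))"
| "aeval \<sigma> (ANum c) = c"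
| "aeval \<sigma> (ANeg a) = - aeval \<sigma> a"
| "aeval \<sigma> (AAdd a b) = aeval \<sigma> a + aeval \<sigma> b"
| "aeval \<sigma> (ASub a b) = aeval \<sigma> a - aeval \<sigma> b"
| "aeval \<sigma> (AMul a b) = aeval \<sigma> a * aeval \<sigma> b"
| "aeval \<sigma> (ADiv a b) = aeval \<sigma> a / aeval \<sigma> b"
| "aeval \<sigma> (AExp a b) = real_expt (aeval \<sigma> a) (aeval \<sigma> b)"


subsection \<open>Limit problems and their solutions\<close>

text \<open>
  The four marks \<open>+\<close>, \<open>-\<close>, \<open>+\<^sub>!\<close> and \<open>-\<^sub>!\<close>, in this order.
\<close>
datatype mark = To_Pos_Inf | To_Neg_Inf | To_Pos_Const | To_Neg_Const

type_synonym 'v limit_problem = "('v aexp \<times> mark) fset"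

definition lvars :: "'v limit_problem \<Rightarrow> 'v set" where
  "lvars L = (\<Union>(a, b) \<in> fset L. avars a)"

fun satisfies_mark :: "(nat \<Rightarrow> real) \<Rightarrow> mark \<Rightarrow> bool" where
  "satisfies_mark f To_Pos_Inf \<longleftrightarrow> filterlim f at_top sequentially"
| "satisfies_mark f To_Neg_Inf \<longleftrightarrow> filterlim f at_bot sequentially"
| "satisfies_mark f To_Pos_Const \<longleftrightarrow> (\<exists>m>0. f \<longlonglongrightarrow> m)"
| "satisfies_mark f To_Neg_Const \<longleftrightarrow> (\<exists>m<0. f \<longlonglongrightarrow> m)"

definition is_solution :: "(nat \<Rightarrow> 'v int_subst) \<Rightarrow> 'v limit_problem \<Rightarrow> bool" where
  "is_solution \<theta> L \<longleftrightarrow>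
     (\<forall>n. lvars L \<subseteq> dom (\<theta> n)) \<and>
     (\<forall>(a, b) \<in> fset L. satisfies_mark (\<lambda>n. aeval (\<theta> n) a) b)"


subsection \<open>Multivariate polynomials\<close>

text \<open>
  A polynomial maps each monomial to its coefficient, and a monomial maps each variable to its
  exponent; the ring structure is the convolution product on finitely supported functions.
\<close>
type_synonym 'v mpoly = "('v \<Rightarrow>\<^sub>0 nat) \<Rightarrow>\<^sub>0 real"

definition mvar :: "'v \<Rightarrow> 'v mpoly" where
  "mvar x = Poly_Mapping.single (Poly_Mapping.single x 1) 1"

definition mconst :: "real \<Rightarrow> 'v mpoly" where
  "mconst c = Poly_Mapping.single 0 c"

definition mvars :: "'v mpoly \<Rightarrow> 'v set" where
  "mvars p = (\<Union>m \<in> Poly_Mapping.keys p. Poly_Mapping.keys m)"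

definition total_degree :: "'v mpoly \<Rightarrow> nat" where
  "total_degree p = Max (insert 0 ((\<lambda>m. \<Sum>x\<in>Poly_Mapping.keys m. Poly_Mapping.lookup m x) ` Poly_Mapping.keys p))"

text \<open>
  Substitution of ring elements \<open>f x\<close> for the variables \<open>x\<close>, where \<open>c\<close> embeds the
  coefficients into the target ring.
\<close>
definition msubst :: "(real \<Rightarrow> 'r) \<Rightarrow> ('v \<Rightarrow> 'r) \<Rightarrow> 'v mpoly \<Rightarrow> 'r::comm_semiring_1" where
  "msubst c f p = (\<Sum>m\<in>Poly_Mapping.keys p. c (Poly_Mapping.lookup p m) * (\<Prod>x\<in>Poly_Mapping.keys m. f x ^ Poly_Mapping.lookup m x))"

definition meval :: "'v int_subst \<Rightarrow> 'v mpoly \<Rightarrow> real" where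
  "meval \<sigma> p = msubst (\<lambda>c. c) (\<lambda>x. real_of_int (the (\<sigma> x))) p"

text \<open>
  \<open>denotes_poly a p\<close>: the expression \<open>a\<close> is (not necessarily in expanded form) the polynomial
  \<open>p\<close>. Divisors must be nonzero constants and exponents natural numbers.
\<close>
inductive denotes_poly :: "'v aexp \<Rightarrow> 'v mpoly \<Rightarrow> bool" where
  "denotes_poly (AVar x) (mvar x)"
| "denotes_poly (ANum c) (mconst c)"
| "denotes_poly a p \<Longrightarrow> denotes_poly (ANeg a) (- p)"
| "denotes_poly a p \<Longrightarrow> denotes_poly b q \<Longrightarrow> denotes_poly (AAdd a b) (p + q)"
| "denotes_poly a p \<Longrightarrow> denotes_poly b q \<Longrightarrow> denotes_poly (ASub a b) (p - q)"
| "denotes_poly a p \<Longrightarrow> denotes_poly b q \<Longrightarrow> denotes_poly (AMul a b) (p * q)"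
| "denotes_poly a p \<Longrightarrow> denotes_poly b (mconst c) \<Longrightarrow> c \<noteq> 0 \<Longrightarrow>
     denotes_poly (ADiv a b) (mconst (1 / c) * p)"
| "denotes_poly a p \<Longrightarrow> denotes_poly b (mconst (real k)) \<Longrightarrow> denotes_poly (AExp a b) (p ^ k)"

definition is_polynomial :: "'v aexp \<Rightarrow> bool" where
  "is_polynomial a \<longleftrightarrow> (\<exists>p. denotes_poly a p)"

lemma mconst_eq_iff: "mconst c = mconst d \<longleftrightarrow> c = d"
  unfolding mconst_def by (metis lookup_single_eq)

inductive_cases denotes_poly_elims:
  "denotes_poly (AVar x) q"
  "denotes_poly (ANum c) q"
  "denotes_poly (ANeg a) q"
  "denotes_poly (AAdd a b) q"
  "denotes_poly (ASub a b) q"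
  "denotes_poly (AMul a b) q"
  "denotes_poly (ADiv a b) q"
  "denotes_poly (AExp a b) q"

lemma denotes_poly_unique: "denotes_poly a p \<Longrightarrow> denotes_poly a q \<Longrightarrow> p = q"
proof (induction arbitrary: q rule: denotes_poly.induct)
  case (1 x)
  from 1 show ?case
    by (rule denotes_poly_elims(1)) (erule sym)
next
  case (2 c)
  from 2 show ?case
    by (rule denotes_poly_elims(2)) (erule sym)
next
  case (3 a p)
  from 3(3) show ?case
    by (rule denotes_poly_elims(3)) (metis 3(2))
next
  case (4 a p b r)
  from 4(5) show ?case
    by (rule denotes_poly_elims(4)) (metis 4(3,4))
next
  case (5 a p b r)
  from 5(5) show ?case
    by (rule denotes_poly_elims(5)) (metis 5(3,4))
next
  case (6 a p b r)
  from 6(5) show ?case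
    by (rule denotes_poly_elims(6)) (metis 6(3,4))
next
  case (7 a p b c)
  from 7(6) show ?case
    by (rule denotes_poly_elims(7)) (metis 7(4,5) mconst_eq_iff)
next
  case (8 a p b k)
  from 8(5) show ?case
    by (rule denotes_poly_elims(8)) (metis 8(3,4) mconst_eq_iff of_nat_eq_iff)
qed

definition poly_of :: "'v aexp \<Rightarrow> 'v mpoly" where
  "poly_of a = (THE p. denotes_poly a p)"

lemma poly_of_eq: "denotes_poly a p \<Longrightarrow> poly_of a = p"
  unfolding poly_of_def using denotes_poly_unique by blast


subsection \<open>Abstract coefficients\<close>

text \<open>
  \<open>M x\<close> and \<open>K x\<close> are the abstract coefficients \<open>m\<^sub>x\<close> and \<open>k\<^sub>x\<close>; being of a separate type, they are
  fresh.
\<close>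
datatype 'v acoeff = M 'v | K 'v

text \<open>
  \<open>a\<sigma>\<^sub>n\<close> as a univariate polynomial in the formal variable \<open>n\<close> whose coefficients are polynomials
  over the abstract coefficients: every \<open>x\<close> is replaced by \<open>m\<^sub>x \<cdot> n + k\<^sub>x\<close>.
\<close>
definition abstract_inst :: "'v aexp \<Rightarrow> 'v acoeff mpoly poly" where
  "abstract_inst a =
     msubst (\<lambda>c. [:mconst c:]) (\<lambda>x. [:mvar (K x), mvar (M x):]) (poly_of a)"

definition acoef :: "'v aexp \<Rightarrow> nat \<Rightarrow> 'v acoeff mpoly" where
  "acoef a i = coeff (abstract_inst a) i"

definition adegree :: "'v aexp \<Rightarrow> nat" where
  "adegree a = total_degree (poly_of a)"


subsection \<open>The SMT encoding\<close>

text \<open>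
  Formulas whose atoms compare an element of \<open>'p\<close> with zero.
\<close>
datatype (atoms: 'p) fm =
    Gt0 'p
  | Lt0 'p
  | Eq0 'p
  | Conj "'p fm fset"
  | Disj "'p fm fset"

primrec holds :: "('p \<Rightarrow> real) \<Rightarrow> 'p fm \<Rightarrow> bool" where
  "holds I (Gt0 p) \<longleftrightarrow> I p > 0"
| "holds I (Lt0 p) \<longleftrightarrow> I p < 0"
| "holds I (Eq0 p) \<longleftrightarrow> I p = 0"
| "holds I (Conj F) \<longleftrightarrow> fBall (holds I |`| F) (\<lambda>b. b)"
| "holds I (Disj F) \<longleftrightarrow> fBex (holds I |`| F) (\<lambda>b. b)"

definition fvars :: "'v mpoly fm \<Rightarrow> 'v set" where
  "fvars \<phi> = (\<Union>p \<in> atoms \<phi>. mvars p)"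

definition models :: "'v int_subst \<Rightarrow> 'v mpoly fm \<Rightarrow> bool" (infix "\<Turnstile>\<^sub>I" 50) where
  "\<sigma> \<Turnstile>\<^sub>I \<phi> \<longleftrightarrow> fvars \<phi> \<subseteq> dom \<sigma> \<and> holds (meval \<sigma>) \<phi>"

definition conj_range :: "nat \<Rightarrow> nat \<Rightarrow> (nat \<Rightarrow> 'p fm) \<Rightarrow> 'p fm" where
  "conj_range i j \<phi> = Conj (fset_of_list (map \<phi> [i..<Suc j]))"

definition disj_range :: "nat \<Rightarrow> nat \<Rightarrow> (nat \<Rightarrow> 'p fm) \<Rightarrow> 'p fm" where
  "disj_range i j \<phi> = Disj (fset_of_list (map \<phi> [i..<Suc j]))"

fun smt_mark :: "'v aexp \<Rightarrow> mark \<Rightarrow> 'v acoeff mpoly fm" where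
  "smt_mark a To_Pos_Inf =
     disj_range 1 (adegree a) (\<lambda>i.
       Conj {|Gt0 (acoef a i), conj_range (i + 1) (adegree a) (\<lambda>j. Eq0 (acoef a j))|})"
| "smt_mark a To_Neg_Inf =
     disj_range 1 (adegree a) (\<lambda>i.
       Conj {|Lt0 (acoef a i), conj_range (i + 1) (adegree a) (\<lambda>j. Eq0 (acoef a j))|})"
| "smt_mark a To_Pos_Const =
     Conj {|conj_range 1 (adegree a) (\<lambda>j. Eq0 (acoef a j)), Gt0 (acoef a 0)|}"
| "smt_mark a To_Neg_Const =
     Conj {|conj_range 1 (adegree a) (\<lambda>j. Eq0 (acoef a j)), Lt0 (acoef a 0)|}"

definition smt :: "'v limit_problem \<Rightarrow> 'v acoeff mpoly fm" where
  "smt L = Conj ((\<lambda>(a, b). smt_mark a b) |`| L)"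

text \<open>
  The integer substitution \<open>\<sigma>\<^sub>n \<circ> \<sigma> = {x/(m\<^sub>x\<sigma> \<cdot> n + k\<^sub>x\<sigma>) | x \<in> V(L)}\<close>. A variable is mapped to an
  integer only if \<open>\<sigma>\<close> is defined on both of its abstract coefficients.
\<close>
definition inst_family :: "'v limit_problem \<Rightarrow> 'v acoeff int_subst \<Rightarrow> nat \<Rightarrow> 'v int_subst" where
  "inst_family L \<sigma> n = (\<lambda>x.
     if x \<in> lvars L then
       (case (\<sigma> (M x), \<sigma> (K x)) of
          (Some m, Some k) \<Rightarrow> Some (m * int n + k)
        | _ \<Rightarrow> None)
     else None)"

end

theory Submission imports Defs begin

text \<open>
  Evaluation of multivariate polynomials is a ring homomorphism, so evaluating an expression under
  \<open>\<sigma>\<^sub>n \<circ> \<sigma>\<close> gives the same number as evaluating the formal polynomial \<open>a\<sigma>\<^sub>n\<close> at \<open>n\<close> and then applying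
  \<open>\<sigma>\<close> to its coefficients. Hence \<open>n \<mapsto> a(\<sigma>\<^sub>n \<circ> \<sigma>)\<close> is a univariate real polynomial of degree at
  most the total degree of \<open>a\<close>, and \<open>smt\<close> prescribes the sign of its leading coefficient and
  whether it is constant, which determines its limit.
\<close>

section \<open>Evaluation is a ring homomorphism\<close>

text \<open>Reduces additive claims about polynomials to single terms; this is how multiplicativity
  of \<open>meval\<close> is obtained.\<close>

lemma poly_mapping_single_add_induct [case_names zero single add]:
  fixes p :: "'a \<Rightarrow>\<^sub>0 'b::comm_monoid_add"
  assumes "P 0"
    and single: "\<And>m c. P (Poly_Mapping.single m c)"
    and add: "\<And>p q. P p \<Longrightarrow> P q \<Longrightarrow> P (p + q)"
  shows "P p"
proof (induction p rule: update_induct)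
  case const
  show ?case by fact
next
  case (update f a b)
  \<comment> \<open>The key \<open>a\<close> is new to \<open>f\<close>, so overwriting there
    amounts to adding.\<close>
  have "Poly_Mapping.update a b f = f + Poly_Mapping.single a b"
    using update(1)
    by (intro poly_mapping_eqI) (auto simp: lookup_update lookup_add lookup_single when_def in_keys_iff)
  then show ?case
    using add[OF update(3) single] by simp
qed

lemma prod_keys_power_add:
  fixes f :: "'v \<Rightarrow> 'r::comm_semiring_1" and m m' :: "'v \<Rightarrow>\<^sub>0 nat"
  shows "(\<Prod>x\<in>Poly_Mapping.keys (m + m'). f x ^ Poly_Mapping.lookup (m + m') x) =
    (\<Prod>x\<in>Poly_Mapping.keys m. f x ^ Poly_Mapping.lookup m x) *
    (\<Prod>x\<in>Poly_Mapping.keys m'. f x ^ Poly_Mapping.lookup m' x)"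
proof -
  let ?S = "Poly_Mapping.keys m \<union> Poly_Mapping.keys m'"
  \<comment> \<open>Variables outside the support have exponent 0 and contribute the factor 1, so
    all three products can run over one index set.\<close>
  have expand: "(\<Prod>x\<in>Poly_Mapping.keys l. f x ^ Poly_Mapping.lookup l x) =
      (\<Prod>x\<in>?S. f x ^ Poly_Mapping.lookup l x)"
    if "Poly_Mapping.keys l \<subseteq> ?S" for l :: "'v \<Rightarrow>\<^sub>0 nat"
    using that by (intro prod.mono_neutral_left) (auto simp: in_keys_iff)
  show ?thesis
    unfolding expand[OF keys_add] expand[OF Un_upper1] expand[OF Un_upper2]
    by (simp add: lookup_add power_add prod.distrib)
qed

lemma meval_single:
  "meval \<sigma> (Poly_Mapping.single m c) =
     c * (\<Prod>x\<in>Poly_Mapping.keys m. real_of_int (the (\<sigma> x)) ^ Poly_Mapping.lookup m x)"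
  by (simp add: meval_def msubst_def)

lemma meval_0 [simp]: "meval \<sigma> 0 = 0"
  by (simp add: meval_def msubst_def)

lemma meval_mconst [simp]: "meval \<sigma> (mconst c) = c"
  by (simp add: mconst_def meval_single)

lemma meval_mvar [simp]: "meval \<sigma> (mvar x) = real_of_int (the (\<sigma> x))"
  by (simp add: mvar_def meval_single)

lemma meval_1 [simp]: "meval \<sigma> 1 = 1"
  using meval_mconst[of \<sigma> 1] by (simp add: mconst_def)

lemma meval_add [simp]: "meval \<sigma> (p + q) = meval \<sigma> p + meval \<sigma> q"
  unfolding meval_def msubst_def
  by (rule setsum_keys_plus_distrib) (simp_all add: algebra_simps)

lemma meval_minus [simp]: "meval \<sigma> (- p) = - meval \<sigma> p"
  using meval_add[of \<sigma> p "- p"] by simp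

lemma meval_diff [simp]: "meval \<sigma> (p - q) = meval \<sigma> p - meval \<sigma> q"
  using meval_add[of \<sigma> p "- q"] by simp

text \<open>Both sides are additive in each factor, so two nested inductions leave only products of
  single terms, where exponents add.\<close>

lemma meval_mult [simp]: "meval \<sigma> (p * q) = meval \<sigma> p * meval \<sigma> q"
proof (induction p rule: poly_mapping_single_add_induct)
  case (single m c)
  show ?case
    by (induction q rule: poly_mapping_single_add_induct)
      (simp_all add: mult_single meval_single prod_keys_power_add ring_distribs)
qed (simp_all add: ring_distribs)

lemma meval_power [simp]: "meval \<sigma> (p ^ k) = meval \<sigma> p ^ k"
  by (induction k) simp_all

lemma meval_sum: "meval \<sigma> (\<Sum>i\<in>A. f i) = (\<Sum>i\<in>A. meval \<sigma> (f i))"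
  by (induction A rule: infinite_finite_induct) simp_all

lemma meval_prod: "meval \<sigma> (\<Prod>i\<in>A. f i) = (\<Prod>i\<in>A. meval \<sigma> (f i))"
  by (induction A rule: infinite_finite_induct) simp_all

text \<open>In the power case the exponent evaluates to a natural number, so
  \<open>real_expt\<close> takes its integer branch and the sign of the base is irrelevant.\<close>

lemma aeval_eq_meval: "denotes_poly a p \<Longrightarrow> aeval \<sigma> a = meval \<sigma> p"
  by (induction rule: denotes_poly.induct) (simp_all add: real_expt_def)

lemma aeval_cong: "(\<And>x. x \<in> avars a \<Longrightarrow> \<sigma> x = \<tau> x) \<Longrightarrow> aeval \<sigma> a = aeval \<tau> a"
  by (induction a) simp_all


section \<open>The coefficients of an instantiated expression\<close>

lemma total_degree_ge:
  assumes "m \<in> Poly_Mapping.keys p"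
  shows "(\<Sum>x\<in>Poly_Mapping.keys m. Poly_Mapping.lookup m x) \<le> total_degree p"
  unfolding total_degree_def using assms by (intro Max_ge) auto

text \<open>Each variable becomes a polynomial of degree at most 1 in \<open>n\<close>, so no
  monomial gains degree. Hence the coefficients up to \<open>adegree a\<close> inspected by
  \<open>smt\<close> are all there are.\<close>

lemma degree_abstract_inst_le: "degree (abstract_inst a) \<le> adegree a"
  unfolding abstract_inst_def msubst_def adegree_def
proof (intro degree_sum_le)
  fix m assume m: "m \<in> Poly_Mapping.keys (poly_of a)"
  let ?g = "\<lambda>x. [:mvar (K x), mvar (M x):] ^ Poly_Mapping.lookup m x"
  have "degree ([:mconst (Poly_Mapping.lookup (poly_of a) m):] * (\<Prod>x\<in>Poly_Mapping.keys m. ?g x))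
      \<le> degree (\<Prod>x\<in>Poly_Mapping.keys m. ?g x)"
    by (rule order_trans[OF degree_mult_le]) simp
  also have "\<dots> \<le> (\<Sum>x\<in>Poly_Mapping.keys m. degree (?g x))"
    using degree_prod_sum_le[of "Poly_Mapping.keys m" ?g] by (simp add: o_def)
  also have "\<dots> \<le> (\<Sum>x\<in>Poly_Mapping.keys m. Poly_Mapping.lookup m x)"
  proof (rule sum_mono)
    fix x assume "x \<in> Poly_Mapping.keys m"
    have "degree [:mvar (K x), mvar (M x):] \<le> 1"
      by (simp add: degree_pCons_le)
    from mult_le_mono1[OF this, of "Poly_Mapping.lookup m x"]
    show "degree (?g x) \<le> Poly_Mapping.lookup m x"
      by (intro order_trans[OF degree_power_le]) simp
  qed
  also have "\<dots> \<le> total_degree (poly_of a)"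
    using m by (rule total_degree_ge)
  finally show "degree ([:mconst (Poly_Mapping.lookup (poly_of a) m):] *
      (\<Prod>x\<in>Poly_Mapping.keys m. ?g x)) \<le> total_degree (poly_of a)" .
qed simp

text \<open>Evaluation commutes with substitution. The number \<open>n\<close> enters as a constant
  polynomial because the coefficients of \<open>abstract_inst a\<close> are themselves
  polynomials.\<close>

lemma meval_poly_abstract_inst:
  "meval \<sigma> (poly (abstract_inst a) (mconst (real n))) =
     meval (\<lambda>x. Some (the (\<sigma> (M x)) * int n + the (\<sigma> (K x)))) (poly_of a)"
  (is "_ = meval ?\<tau> _")
proof -
  have "meval \<sigma> (poly [:mvar (K x), mvar (M x):] (mconst (real n))) = real_of_int (the (?\<tau> x))" for x
    by (simp add: algebra_simps)
  moreover have "meval \<sigma> (poly [:mconst c:] (mconst (real n))) = c" for c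
    by simp
  ultimately show ?thesis
    unfolding abstract_inst_def msubst_def meval_def[of ?\<tau>]
    by (simp only: poly_sum poly_mult poly_prod poly_power
        meval_sum meval_mult meval_prod meval_power)
qed

lemma meval_poly_eq_sum:
  assumes "degree P \<le> d"
  shows "meval \<sigma> (poly P (mconst c)) = (\<Sum>i\<le>d. meval \<sigma> (coeff P i) * c ^ i)"
proof -
  have "meval \<sigma> (poly P (mconst c)) = (\<Sum>i\<le>degree P. meval \<sigma> (coeff P i) * c ^ i)"
    by (simp add: poly_altdef meval_sum)
  also have "\<dots> = (\<Sum>i\<le>d. meval \<sigma> (coeff P i) * c ^ i)"
    using assms by (intro sum.mono_neutral_left) (auto simp: coeff_eq_0)
  finally show ?thesis .
qed

lemma inst_family_eq:
  assumes "M ` lvars L \<union> K ` lvars L \<subseteq> dom \<sigma>" and "x \<in> lvars L"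
  shows "inst_family L \<sigma> n x = Some (the (\<sigma> (M x)) * int n + the (\<sigma> (K x)))"
proof -
  obtain m k where "\<sigma> (M x) = Some m" "\<sigma> (K x) = Some k"
    using assms by blast
  then show ?thesis
    using assms(2) by (simp add: inst_family_def)
qed

lemma aeval_inst_family:
  assumes dom: "M ` lvars L \<union> K ` lvars L \<subseteq> dom \<sigma>"
    and "avars a \<subseteq> lvars L" and "is_polynomial a"
  shows "aeval (inst_family L \<sigma> n) a = (\<Sum>i\<le>adegree a. meval \<sigma> (acoef a i) * real n ^ i)"
proof -
  \<comment> \<open>A total extension of the instance; its values outside \<open>lvars L\<close> are
    arbitrary but do not affect \<open>a\<close>.\<close>
  let ?\<tau> = "\<lambda>x. Some (the (\<sigma> (M x)) * int n + the (\<sigma> (K x)))"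
  have "aeval (inst_family L \<sigma> n) a = aeval ?\<tau> a"
    by (rule aeval_cong) (rule inst_family_eq[OF dom subsetD[OF assms(2)]])
  also have "\<dots> = meval ?\<tau> (poly_of a)"
    using assms(3) by (auto simp: is_polynomial_def aeval_eq_meval poly_of_eq)
  also have "\<dots> = meval \<sigma> (poly (abstract_inst a) (mconst (real n)))"
    by (simp add: meval_poly_abstract_inst)
  also have "\<dots> = (\<Sum>i\<le>adegree a. meval \<sigma> (acoef a i) * real n ^ i)"
    unfolding acoef_def by (rule meval_poly_eq_sum[OF degree_abstract_inst_le])
  finally show ?thesis .
qed


section \<open>Limits of polynomial sequences\<close>

lemma sum_powers_truncate:
  fixes c :: "nat \<Rightarrow> 'a::comm_semiring_1"
  assumes "i \<le> d" and "\<And>j. i < j \<Longrightarrow> j \<le> d \<Longrightarrow> c j = 0"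
  shows "(\<Sum>j\<le>d. c j * x ^ j) = (\<Sum>j\<le>i. c j * x ^ j)"
  using assms by (intro sum.mono_neutral_right) auto

lemma filterlim_sum_powers_at_top:
  fixes c :: "nat \<Rightarrow> real"
  assumes "c (Suc i) > 0"
  shows "filterlim (\<lambda>n. \<Sum>j\<le>Suc i. c j * real n ^ j) at_top sequentially"
  using assms
proof (induction i arbitrary: c)
  case 0
  then have "filterlim (\<lambda>n. c 0 + c 1 * real n) at_top sequentially"
    by (intro filterlim_tendsto_add_at_top[OF tendsto_const]
        filterlim_tendsto_pos_mult_at_top[OF tendsto_const] filterlim_real_sequentially) simp_all
  then show ?case by simp
next
  case (Suc i)
  \<comment> \<open>Horner's scheme shifts the coefficients by one, which is why \<open>c\<close> is
    generalised in the induction.\<close>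
  have horner: "(\<Sum>j\<le>Suc (Suc i). c j * real n ^ j) =
      c 0 + real n * (\<Sum>j\<le>Suc i. c (Suc j) * real n ^ j)" for n
    by (subst sum.atMost_Suc_shift) (simp add: sum_distrib_left algebra_simps)
  have "filterlim (\<lambda>n. \<Sum>j\<le>Suc i. c (Suc j) * real n ^ j) at_top sequentially"
    using Suc.prems by (rule Suc.IH)
  then show ?case
    unfolding horner
    by (intro filterlim_tendsto_add_at_top[OF tendsto_const]
        filterlim_at_top_mult_at_top filterlim_real_sequentially)
qed

lemma sum_powers_at_top:
  fixes c :: "nat \<Rightarrow> real"
  assumes "1 \<le> i" "i \<le> d" "c i > 0" "\<And>j. i < j \<Longrightarrow> j \<le> d \<Longrightarrow> c j = 0"
  shows "filterlim (\<lambda>n. \<Sum>j\<le>d. c j * real n ^ j) at_top sequentially"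
proof -
  obtain k where "i = Suc k"
    using assms(1) by (cases i) auto
  then show ?thesis
    using filterlim_sum_powers_at_top[of c k] assms sum_powers_truncate[of i d c] by simp
qed

lemma sum_powers_at_bot:
  fixes c :: "nat \<Rightarrow> real"
  assumes "1 \<le> i" "i \<le> d" "c i < 0" "\<And>j. i < j \<Longrightarrow> j \<le> d \<Longrightarrow> c j = 0"
  shows "filterlim (\<lambda>n. \<Sum>j\<le>d. c j * real n ^ j) at_bot sequentially"
  using sum_powers_at_top[of i d "\<lambda>j. - c j"] assms
  by (simp add: filterlim_uminus_at_bot sum_negf)


section \<open>Soundness of the encoding\<close>

lemma holds_conj_range [simp]:
  "holds I (conj_range i j \<phi>) \<longleftrightarrow> (\<forall>k. i \<le> k \<longrightarrow> k \<le> j \<longrightarrow> holds I (\<phi> k))"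
  by (auto simp: conj_range_def fset_of_list.rep_eq)

lemma holds_disj_range [simp]:
  "holds I (disj_range i j \<phi>) \<longleftrightarrow> (\<exists>k. i \<le> k \<and> k \<le> j \<and> holds I (\<phi> k))"
  by (auto simp: disj_range_def fset_of_list.rep_eq)

lemma smt_mark_sound:
  assumes "holds (meval \<sigma>) (smt_mark a b)"
  shows "satisfies_mark (\<lambda>n. \<Sum>j\<le>adegree a. meval \<sigma> (acoef a j) * real n ^ j) b"
proof (cases b)
  case To_Pos_Inf
  then show ?thesis
    using assms by (auto simp: Suc_le_eq intro: sum_powers_at_top)
next
  case To_Neg_Inf
  then show ?thesis
    using assms by (auto simp: Suc_le_eq intro: sum_powers_at_bot)
next
  case To_Pos_Const
  \<comment> \<open>Truncation at 0 leaves the constant sequence \<open>a_0\<close>, which is its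
    own limit.\<close>
  then show ?thesis
    using assms sum_powers_truncate[of 0 "adegree a" "\<lambda>j. meval \<sigma> (acoef a j)"]
    by (auto simp: Suc_le_eq)
next
  case To_Neg_Const
  then show ?thesis
    using assms sum_powers_truncate[of 0 "adegree a" "\<lambda>j. meval \<sigma> (acoef a j)"]
    by (auto simp: Suc_le_eq)
qed

text \<open>The domain assumption is not implied by the model: for \<open>x\<close> marked
  \<open>+\<close>, the formula mentions \<open>M x\<close> but not \<open>K x\<close>.\<close>

theorem theorem5p26:
  fixes L :: "'v limit_problem" and \<sigma> :: "'v acoeff int_subst"
  assumes "\<And>a b. (a, b) |\<in>| L \<Longrightarrow> is_polynomial a"
    and "M ` lvars L \<union> K ` lvars L \<subseteq> dom \<sigma>"
    and "\<sigma> \<Turnstile>\<^sub>I smt L"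
  shows "is_solution (inst_family L \<sigma>) L"
  unfolding is_solution_def
proof (intro conjI allI ballI subsetI)
  fix n x assume "x \<in> lvars L"
  then show "x \<in> dom (inst_family L \<sigma> n)"
    using inst_family_eq[OF assms(2)] by blast
next
  fix ab assume ab: "ab \<in> fset L"
  obtain a b where [simp]: "ab = (a, b)" by fastforce
  have "avars a \<subseteq> lvars L"
    using ab by (force simp: lvars_def)
  moreover have "is_polynomial a"
    using ab assms(1) by auto
  moreover have "holds (meval \<sigma>) (smt_mark a b)"
    using ab assms(3) by (force simp: models_def smt_def)
  ultimately show "case ab of (a, b) \<Rightarrow> satisfies_mark (\<lambda>n. aeval (inst_family L \<sigma> n) a) b"
    using smt_mark_sound by (simp add: aeval_inst_family[OF assms(2)])
qed

end
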